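(* Let $G=(V,E)$ be a finite connected simple graph, let $w:E\to(0,\infty)$ be a positive edge weight, and let $e=xy\in E$ satisfy $\operatorname{girth}_G(e)\ge4$. Then $$\sigma_e(w)=\min\Bigl\{\sum_{u\in X_e}a_ug_u+\sum_{v\in Y_e}b_vh_v:\ g_u,h_v\ge0,\ g_u+h_v\ge 3-d(u,v)\ \text{ for all }u\in X_e,\ v\in Y_e\Bigr\},$$ where the minimum is over real vectors $(g_u)_{u\in X_e}$, $(h_v)_{v\in Y_e}$. Equivalently, $$\sigma_e(w)=\max_{\gamma\ge0}\ \sum_{u\in X_e,\,v\in Y_e}\bigl(3-d(u,v)\bigr)\gamma_{uv},$$ where the maximum is over nonnegative real arrays $\gamma=(\gamma_{uv})_{u\in X_e,v\in Y_e}$ subject to $$\sum_{v\in Y_e}\gamma_{uv}\le a_u\quad(u\in X_e),\qquad \sum_{u\in X_e}\gamma_{uv}\le b_v\quad(v\in Y_e).$$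
   Context: Graphs are finite, simple and undirected. For an edge $e$ of $G$, the local girth $\operatorname{girth}_G(e)$ is the minimum length of a cycle of $G$ containing $e$, with $\operatorname{girth}_G(e)=\infty$ if $e$ lies on no cycle. $N(x)$ is the set of neighbors of $x$. Lin--Lu--Yau curvature with fixed combinatorial distance: let $G=(V,E)$ be finite and connected, and let $d$ be its combinatorial (shortest-path) distance. For a positive edge weight $w:E\to(0,\infty)$ put $d_x^w:=\sum_{z\sim x}w_{xz}$. For $\alpha\in[0,1]$ and $x\in V$ let $\mu_x^{\alpha,w}$ be the probability measure on $V$ with $\mu_x^{\alpha,w}(x)=\alpha$, $\mu_x^{\alpha,w}(z)=(1-\alpha)w_{xz}/d_x^w$ if $z\sim x$, and $\mu_x^{\alpha,w}(z)=0$ otherwise. Let $W_1$ be the $1$-Wasserstein distance with respect to $d$ (independent of $w$). For an edge $e=xy$, put $\kappa_\alpha^w(x,y):=1-W_1(\mu_x^{\alpha,w},\mu_y^{\alpha,w})$ and $$\kappa_{\mathrm{LLY}}^w(e)=\kappa_{\mathrm{LLY}}^w(x,y):=\lim_{\alpha\to1^-}\frac{\kappa_\alpha^w(x,y)}{1-\alpha}.$$ For an edge $e=xy$: $q_e^w:=\frac{w_{xy}}{d_x^w}+\frac{w_{xy}}{d_y^w}$; the short-cycle surplus is $\sigma_e(w):=\kappa_{\mathrm{LLY}}^w(e)-(2q_e^w-2)$; $X_e:=N(x)\setminus\{y\}$, $Y_e:=N(y)\setminus\{x\}$; $a_u:=w_{xu}/d_x^w$ for $u\in X_e$ and $b_v:=w_{yv}/d_y^w$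 for $v\in Y_e$. *)

theory Defs
  imports "HOL-Probability.Probability" "Graph_Theory.Graph_Theory"
begin

section \<open>Graphs\<close>

text \<open>
  A finite simple undirected graph is a \<^locale>\<open>pair_graph\<close>: an undirected edge $uv$ is the
  pair of arcs $(u,v)$, $(v,u)$.
  An edge weight is a function \<open>w\<close> on two-element sets, so that $w_{uv}$ is \<open>w {u, v}\<close>.
\<close>

definition nbrs :: "'a pair_pre_digraph \<Rightarrow> 'a \<Rightarrow> 'a set" where
  "nbrs G x = {z. (x, z) \<in> parcs G}"

definition graph_dist :: "'a pair_pre_digraph \<Rightarrow> 'a \<Rightarrow> 'a \<Rightarrow> real" where
  "graph_dist G u v = real_of_ereal (wf_digraph.\<mu> (with_proj G) (\<lambda>_. 1) u v)"

text \<open>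
  The notion of a cycle of a digraph admits the closed walk $u \to v \to u$;
  the condition on the length excludes it. The infimum of the empty set is \<open>\<infinity>\<close>.
\<close>

definition local_girth :: "'a pair_pre_digraph \<Rightarrow> 'a \<Rightarrow> 'a \<Rightarrow> enat" where
  "local_girth G x y =
     (INF p\<in>{p. pre_digraph.cycle (with_proj G) p \<and> 3 \<le> length p \<and>
                ((x, y) \<in> set p \<or> (y, x) \<in> set p)}. enat (length p))"

definition pos_weight :: "'a pair_pre_digraph \<Rightarrow> ('a set \<Rightarrow> real) \<Rightarrow> bool" where
  "pos_weight G w \<longleftrightarrow> (\<forall>(u, v)\<in>parcs G. 0 < w {u, v})"

definition wdeg :: "'a pair_pre_digraph \<Rightarrow> ('a set \<Rightarrow> real) \<Rightarrow> 'a \<Rightarrow> real" where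
  "wdeg G w x = (\<Sum>z\<in>nbrs G x. w {x, z})"

section \<open>Wasserstein distance and Lin--Lu--Yau curvature\<close>

definition couplings :: "'a pmf \<Rightarrow> 'a pmf \<Rightarrow> ('a \<times> 'a) pmf set" where
  "couplings \<mu> \<nu> = {\<pi>. map_pmf fst \<pi> = \<mu> \<and> map_pmf snd \<pi> = \<nu>}"

text \<open>Only used for measures of finite support, where all the expectations are finite sums.\<close>

definition wasserstein1 :: "('a \<Rightarrow> 'a \<Rightarrow> real) \<Rightarrow> 'a pmf \<Rightarrow> 'a pmf \<Rightarrow> real" where
  "wasserstein1 d \<mu> \<nu> = (INF \<pi>\<in>couplings \<mu> \<nu>. measure_pmf.expectation \<pi> (\<lambda>(a, b). d a b))"

definition lly_mass ::
    "'a pair_pre_digraph \<Rightarrow> ('a set \<Rightarrow> real) \<Rightarrow> real \<Rightarrow> 'a \<Rightarrow> 'a \<Rightarrow> real" where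
  "lly_mass G w \<alpha> x z =
     (if z = x then \<alpha>
      else if z \<in> nbrs G x then (1 - \<alpha>) * w {x, z} / wdeg G w x
      else 0)"

text \<open>Lemma \<open>pmf_lly_measure\<close> below shows that this is the measure with mass function \<open>lly_mass\<close>.\<close>

definition lly_measure ::
    "'a pair_pre_digraph \<Rightarrow> ('a set \<Rightarrow> real) \<Rightarrow> real \<Rightarrow> 'a \<Rightarrow> 'a pmf" where
  "lly_measure G w \<alpha> x = embed_pmf (lly_mass G w \<alpha> x)"

definition alpha_curvature ::
    "'a pair_pre_digraph \<Rightarrow> ('a set \<Rightarrow> real) \<Rightarrow> real \<Rightarrow> 'a \<Rightarrow> 'a \<Rightarrow> real" where
  "alpha_curvature G w \<alpha> x y =
     1 - wasserstein1 (graph_dist G) (lly_measure G w \<alpha> x) (lly_measure G w \<alpha> y)"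

text \<open>Lemma \<open>lly_curvature_tendsto\<close> below shows that the limit exists.\<close>

definition lly_curvature ::
    "'a pair_pre_digraph \<Rightarrow> ('a set \<Rightarrow> real) \<Rightarrow> 'a \<Rightarrow> 'a \<Rightarrow> real" where
  "lly_curvature G w x y = Lim (at_left 1) (\<lambda>\<alpha>. alpha_curvature G w \<alpha> x y / (1 - \<alpha>))"

definition edge_q :: "'a pair_pre_digraph \<Rightarrow> ('a set \<Rightarrow> real) \<Rightarrow> 'a \<Rightarrow> 'a \<Rightarrow> real" where
  "edge_q G w x y = w {x, y} / wdeg G w x + w {x, y} / wdeg G w y"

definition short_cycle_surplus ::
    "'a pair_pre_digraph \<Rightarrow> ('a set \<Rightarrow> real) \<Rightarrow> 'a \<Rightarrow> 'a \<Rightarrow> real" where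
  "short_cycle_surplus G w x y = lly_curvature G w x y - (2 * edge_q G w x y - 2)"

section \<open>The two linear programs\<close>

text \<open>An attained minimum or maximum of a possibly infinite set of reals.\<close>

definition is_minimum :: "real set \<Rightarrow> real \<Rightarrow> bool" where
  "is_minimum S m \<longleftrightarrow> m \<in> S \<and> (\<forall>s\<in>S. m \<le> s)"

definition is_maximum :: "real set \<Rightarrow> real \<Rightarrow> bool" where
  "is_maximum S m \<longleftrightarrow> m \<in> S \<and> (\<forall>s\<in>S. s \<le> m)"

section \<open>Well-definedness of the curvature\<close>

context pair_graph
begin

lemma nbrs_subset: "nbrs G x \<subseteq> pverts G"
  by (auto simp: nbrs_def dest: in_arcsD2)

lemma finite_nbrs: "finite (nbrs G x)"
  using nbrs_subset pair_finite_verts finite_subset by blast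

lemma not_in_nbrs: "x \<notin> nbrs G x"
  using pair_no_loops by (force simp: nbrs_def)

lemma wdeg_pos:
  assumes "pos_weight G w" and "(x, y) \<in> parcs G"
  shows "wdeg G w x > 0"
  unfolding wdeg_def
  by (rule sum_pos) (use assms finite_nbrs in \<open>auto simp: nbrs_def pos_weight_def\<close>)

lemma pmf_lly_measure:
  assumes w: "pos_weight G w" and e: "(x, y) \<in> parcs G"
    and \<alpha>: "0 \<le> \<alpha>" "\<alpha> \<le> 1"
  shows "pmf (lly_measure G w \<alpha> x) z = lly_mass G w \<alpha> x z"
  unfolding lly_measure_def
proof (rule pmf_embed_pmf)
  have D: "wdeg G w x > 0" using wdeg_pos[OF w e] .
  have wn: "w {x, z} > 0" if "z \<in> nbrs G x" for z
    using w that by (auto simp: nbrs_def pos_weight_def)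
  show nn: "0 \<le> lly_mass G w \<alpha> x z" for z
    using \<alpha> D less_imp_le[OF wn] by (auto simp: lly_mass_def)
  let ?S = "insert x (nbrs G x)"
  have "(\<integral>\<^sup>+ z. ennreal (lly_mass G w \<alpha> x z) \<partial>count_space UNIV) =
      (\<Sum>z\<in>?S. ennreal (lly_mass G w \<alpha> x z))"
    by (rule nn_integral_count_space')
       (use finite_nbrs in \<open>auto simp: lly_mass_def\<close>)
  also have "\<dots> = ennreal (\<Sum>z\<in>?S. lly_mass G w \<alpha> x z)"
    by (rule sum_ennreal) (rule nn)
  also have "(\<Sum>z\<in>?S. lly_mass G w \<alpha> x z) =
      \<alpha> + (\<Sum>z\<in>nbrs G x. (1 - \<alpha>) * w {x, z} / wdeg G w x)"
    using finite_nbrs not_in_nbrs by (auto simp: lly_mass_def intro!: sum.cong)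
  also have "\<dots> = \<alpha> + (1 - \<alpha>) * wdeg G w x / wdeg G w x"
    by (simp add: wdeg_def sum_divide_distrib sum_distrib_left)
  also have "\<dots> = 1" using D by simp
  finally show "(\<integral>\<^sup>+ z. ennreal (lly_mass G w \<alpha> x z) \<partial>count_space UNIV) = 1" by simp
qed

lemma set_pmf_lly_measure:
  assumes "pos_weight G w" and "(x, y) \<in> parcs G"
    and "0 \<le> \<alpha>" "\<alpha> \<le> 1"
  shows "set_pmf (lly_measure G w \<alpha> x) \<subseteq> pverts G"
  using nbrs_subset[of x] in_arcsD1[OF assms(2)]
  by (auto simp: set_pmf_iff pmf_lly_measure[OF assms] lly_mass_def split: if_splits)

lemma graph_dist_nonneg: "0 \<le> graph_dist G u v"
  unfolding graph_dist_def
proof (rule real_of_ereal_pos)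
  show "0 \<le> \<mu> (\<lambda>_. 1) u v"
    unfolding \<mu>_def by (rule INF_greatest) (auto intro: pos_cost_pos_awalk_cost)
qed

lemma graph_dist_edge:
  assumes "(x, y) \<in> parcs G"
  shows "graph_dist G x y = 1"
proof -
  have ne: "x \<noteq> y" using pair_no_loops[OF assms] by simp
  have "\<mu> (\<lambda>_. 1) x y \<le> ereal (awalk_cost (\<lambda>_. 1) [(x, y)])"
    by (rule min_cost_le_walk_cost)
       (use assms in_arcsD1 in_arcsD2 in \<open>auto simp: awalk_def\<close>)
  moreover have "1 \<le> \<mu> (\<lambda>_. 1) x y"
    unfolding \<mu>_def
  proof (rule INF_greatest)
    fix p assume "p \<in> {p. awalk x p y}"
    then have "p \<noteq> []" using ne by (auto simp: awalk_def)
    then show "1 \<le> ereal (awalk_cost (\<lambda>_. 1) p)"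
      by (cases p) (auto simp: one_ereal_def awalk_cost_def intro!: sum_list_nonneg)
  qed
  ultimately have "\<mu> (\<lambda>_. 1) x y = 1"
    by (simp add: one_ereal_def awalk_cost_def)
  then show ?thesis by (simp add: graph_dist_def)
qed

end

lemma set_pmf_coupling:
  assumes "\<pi> \<in> couplings \<mu> \<nu>"
  shows "set_pmf \<pi> \<subseteq> set_pmf \<mu> \<times> set_pmf \<nu>"
  using assms by (force simp: couplings_def)

lemma coupling_atom_ge:
  assumes "\<pi> \<in> couplings \<mu> \<nu>"
  shows "pmf \<mu> x + pmf \<nu> y - 1 \<le> pmf \<pi> (x, y)"
proof -
  have *: "pmf \<mu> x = measure \<pi> (fst -` {x})" "pmf \<nu> y = measure \<pi> (snd -` {y})"
    using assms by (auto simp: couplings_def pmf_map)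
  have "measure \<pi> (fst -` {x} \<union> snd -` {y}) =
      measure \<pi> (fst -` {x}) + measure \<pi> (snd -` {y}) - measure \<pi> (fst -` {x} \<inter> snd -` {y})"
    by (rule measure_Un3) (auto simp: measure_pmf.fmeasurable_eq_sets)
  moreover have "fst -` {x} \<inter> snd -` {y} = {(x, y)}" by auto
  moreover have "measure \<pi> (fst -` {x} \<union> snd -` {y}) \<le> 1" by simp
  ultimately show ?thesis using * by (simp add: measure_pmf_single)
qed

lemma pair_pmf_coupling: "pair_pmf \<mu> \<nu> \<in> couplings \<mu> \<nu>"
  by (simp add: couplings_def map_fst_pair_pmf map_snd_pair_pmf)

lemma wasserstein1_le:
  assumes "\<And>a b. 0 \<le> d a b" and "\<pi> \<in> couplings \<mu> \<nu>"
  shows "wasserstein1 d \<mu> \<nu> \<le> measure_pmf.expectation \<pi> (\<lambda>(a, b). d a b)"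
  unfolding wasserstein1_def
  by (rule cINF_lower) (use assms in \<open>auto intro!: bdd_belowI2[where m=0] Bochner_Integration.integral_nonneg\<close>)

context pair_graph
begin

lemma lly_curvature_tendsto:
  assumes w: "pos_weight G w" and e: "(x, y) \<in> parcs G"
  shows "((\<lambda>\<alpha>. alpha_curvature G w \<alpha> x y / (1 - \<alpha>)) \<longlongrightarrow> lly_curvature G w x y) (at_left 1)"
proof -
  define d where "d = graph_dist G"
  define m where "m = (\<lambda>\<alpha>. lly_measure G w \<alpha> x)"
  define n where "n = (\<lambda>\<alpha>. lly_measure G w \<alpha> y)"
  define f where "f = (\<lambda>\<alpha>. wasserstein1 d (m \<alpha>) (n \<alpha>))"
  define q where "q = (\<lambda>\<alpha>. (1 - f \<alpha>) / (1 - \<alpha>))"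
  have e': "(y, x) \<in> parcs G"
    using pair_sym_arcs e by (auto simp: symmetric_def dest: symD)
  have d0: "0 \<le> d a b" for a b by (simp add: d_def graph_dist_nonneg)
  have dxy: "d x y = 1" using graph_dist_edge[OF e] by (simp add: d_def)
  have fin: "finite (set_pmf \<pi>)" if "\<pi> \<in> couplings (m \<alpha>) (n \<alpha>)" "0 \<le> \<alpha>" "\<alpha> \<le> 1" for \<pi> \<alpha>
    by (rule finite_subset[OF set_pmf_coupling[OF that(1)]])
       (use finite_subset[OF set_pmf_lly_measure[OF w e that(2,3)] pair_finite_verts]
            finite_subset[OF set_pmf_lly_measure[OF w e' that(2,3)] pair_finite_verts]
         in \<open>auto simp: m_def n_def\<close>)
  have lower: "2 * \<alpha> - 1 \<le> f \<alpha>" if \<alpha>: "0 \<le> \<alpha>" "\<alpha> \<le> 1" for \<alpha>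
    unfolding f_def wasserstein1_def
  proof (rule cINF_greatest)
    show "couplings (m \<alpha>) (n \<alpha>) \<noteq> {}" using pair_pmf_coupling by blast
    fix \<pi> assume \<pi>: "\<pi> \<in> couplings (m \<alpha>) (n \<alpha>)"
    have "2 * \<alpha> - 1 \<le> pmf \<pi> (x, y)"
      using coupling_atom_ge[OF \<pi>, of x y] pmf_lly_measure[OF w e \<alpha>, of x]
        pmf_lly_measure[OF w e' \<alpha>, of y] by (simp add: m_def n_def lly_mass_def)
    also have "\<dots> = measure_pmf.expectation \<pi> (indicator {(x, y)})"
      by (simp add: measure_pmf_single)
    also have "\<dots> \<le> measure_pmf.expectation \<pi> (\<lambda>(a, b). d a b)"
      by (rule integral_mono)
         (use fin[OF \<pi> \<alpha>] d0 dxy in \<open>auto intro: integrable_measure_pmf_finite simp: indicator_def\<close>)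
    finally show "2 * \<alpha> - 1 \<le> measure_pmf.expectation \<pi> (\<lambda>(a, b). d a b)" .
  qed
  have qmono: "q \<alpha> \<le> q \<beta>" if ab: "0 \<le> \<alpha>" "\<alpha> \<le> \<beta>" "\<beta> < 1" for \<alpha> \<beta>
  proof -
    define t where "t = (1 - \<beta>) / (1 - \<alpha>)"
    have t: "0 < t" "t \<le> 1" and t\<alpha>: "t * (1 - \<alpha>) = 1 - \<beta>"
      using ab by (auto simp: t_def field_simps)
    have \<alpha>1: "\<alpha> \<le> 1" and \<beta>: "0 \<le> \<beta>" "\<beta> \<le> 1" using ab by auto
    have "f \<beta> \<le> t * E + (1 - t)"
      if "\<pi> \<in> couplings (m \<alpha>) (n \<alpha>)" "E = measure_pmf.expectation \<pi> (\<lambda>(a, b). d a b)" for \<pi> E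
    proof -
      define \<rho> where "\<rho> = bernoulli_pmf t \<bind> (\<lambda>b. if b then \<pi> else return_pmf (x, y))"
      have mm: "bernoulli_pmf t \<bind> (\<lambda>b. if b then lly_measure G w \<alpha> u else return_pmf u) = lly_measure G w \<beta> u"
        if "(u, v) \<in> parcs G" for u v
      proof (rule pmf_eqI)
        fix z
        have "pmf (bernoulli_pmf t \<bind> (\<lambda>b. if b then lly_measure G w \<alpha> u else return_pmf u)) z
          = t * lly_mass G w \<alpha> u z + (1 - t) * indicator {z} u"
          using t by (simp add: pmf_bind pmf_lly_measure[OF w that ab(1) \<alpha>1])
        also have "\<dots> = lly_mass G w \<beta> u z"
        proof (cases "z = u")
          case True
          have "t * \<alpha> + (1 - t) = \<beta>" using t\<alpha> by (simp add: algebra_simps)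
          then show ?thesis using True by (simp add: lly_mass_def)
        next
          case False
          then show ?thesis by (simp add: lly_mass_def t\<alpha> flip: mult.assoc)
        qed
        finally show "pmf (bernoulli_pmf t \<bind> (\<lambda>b. if b then lly_measure G w \<alpha> u else return_pmf u)) z
          = pmf (lly_measure G w \<beta> u) z"
          by (simp add: pmf_lly_measure[OF w that \<beta>])
      qed
      have "\<rho> \<in> couplings (m \<beta>) (n \<beta>)"
        using that(1) mm[OF e] mm[OF e']
        by (simp add: couplings_def \<rho>_def map_bind_pmf m_def n_def if_distrib cong: if_cong)
      then have "f \<beta> \<le> measure_pmf.expectation \<rho> (\<lambda>(a, b). d a b)"
        unfolding f_def by (rule wasserstein1_le[OF d0])
      also have "\<dots> = t * E + (1 - t)"
        unfolding \<rho>_def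
        by (subst pmf_expectation_bind[where A=UNIV])
           (use t fin[OF that(1) ab(1) \<alpha>1] that(2) dxy
             in \<open>auto simp: UNIV_bool split: if_splits\<close>)
      finally show ?thesis .
    qed
    then have "(f \<beta> - (1 - t)) / t \<le> E"
      if "\<pi> \<in> couplings (m \<alpha>) (n \<alpha>)" "E = measure_pmf.expectation \<pi> (\<lambda>(a, b). d a b)" for \<pi> E
      using that t by (fastforce simp: field_simps)
    then have "(f \<beta> - (1 - t)) / t \<le> f \<alpha>"
      unfolding f_def[THEN fun_cong, of \<alpha>] wasserstein1_def
      by (intro cINF_greatest) (use pair_pmf_coupling in blast)+
    then have "f \<beta> - (1 - t) \<le> t * f \<alpha>" using t by (simp add: field_simps)
    then have "t * (1 - f \<alpha>) \<le> 1 - f \<beta>" by (simp add: algebra_simps)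
    then show ?thesis using ab by (simp add: q_def t_def field_simps)
  qed
  have qle: "q \<alpha> \<le> 2" if "0 \<le> \<alpha>" "\<alpha> < 1" for \<alpha>
    using lower[of \<alpha>] that by (simp add: q_def field_simps)
  define L where "L = (SUP \<alpha>\<in>{0..<1}. q \<alpha>)"
  have bdd: "bdd_above (q ` {0..<1})" using qle by (auto intro!: bdd_aboveI2[where M=2])
  have "(q \<longlongrightarrow> L) (at_left 1)"
  proof (rule order_tendstoI)
    fix a assume "a < L"
    then obtain \<alpha> where \<alpha>: "\<alpha> \<in> {0..<1}" "a < q \<alpha>"
      unfolding L_def using less_cSUP_iff[OF _ bdd, of a] by auto
    have "\<forall>\<^sub>F \<beta> in at_left 1. \<beta> \<in> {\<alpha><..<1}"
      using \<alpha> eventually_at_left_real by auto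
    then show "\<forall>\<^sub>F \<beta> in at_left 1. a < q \<beta>"
      by eventually_elim (use \<alpha> qmono[of \<alpha>] in \<open>force intro: less_le_trans\<close>)
  next
    fix a assume "L < a"
    have "\<forall>\<^sub>F \<beta> in at_left 1. \<beta> \<in> {0<..<1::real}"
      by (rule eventually_at_left_real) simp
    then show "\<forall>\<^sub>F \<beta> in at_left 1. q \<beta> < a"
    proof eventually_elim
      case (elim \<beta>)
      have "q \<beta> \<le> L" unfolding L_def by (rule cSUP_upper[OF _ bdd]) (use elim in auto)
      then show ?case using \<open>L < a\<close> by simp
    qed
  qed
  moreover have "q = (\<lambda>\<alpha>. alpha_curvature G w \<alpha> x y / (1 - \<alpha>))"
    by (simp add: q_def f_def alpha_curvature_def m_def n_def d_def fun_eq_iff)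
  ultimately show ?thesis
    by (simp add: lly_curvature_def tendsto_Lim)
qed

end

end

theory Submission
  imports Defs
begin

text \<open>
  Write \<open>\<epsilon> = 1 - \<alpha>\<close> and let \<open>\<mu>\<^sub>x\<close>, \<open>\<mu>\<^sub>y\<close> be the two measures at idleness \<open>\<alpha>\<close>. As \<open>e = xy\<close> lies on
  no triangle, \<open>X\<close> and \<open>Y\<close> are disjoint, and the distances from a point of the support of \<open>\<mu>\<^sub>x\<close> to
  one of the support of \<open>\<mu>\<^sub>y\<close> are known except for \<open>d u v\<close> with \<open>u \<in> X\<close>, \<open>v \<in> Y\<close>:
  \<open>d u y = d x v = 2\<close>, and the rest are 0 or 1. The default way of
  moving mass from \<open>u\<close> to \<open>v\<close> passes through \<open>e\<close> and costs 3; a short cycle through \<open>e\<close> allows a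
  shortcut of cost \<open>d u v\<close>, which saves \<open>3 - d u v\<close> per unit. The surplus is the largest
  total saving, which is the maximum in the theorem.

  To make this precise, both sides of Kantorovich duality are written down explicitly.
  A feasible \<open>\<gamma>\<close> gives a coupling of \<open>\<mu>\<^sub>x\<close> and \<open>\<mu>\<^sub>y\<close>: move \<open>\<epsilon> \<gamma> u v\<close> directly from \<open>u\<close> to \<open>v\<close>, the
  remaining mass at \<open>u\<close> to \<open>y\<close>, fill up \<open>v\<close> from \<open>x\<close>, let the common mass at
  \<open>x\<close> and \<open>y\<close> rest, and move what is left at \<open>x\<close> to \<open>y\<close>. Its cost is
  \<open>1 + \<epsilon> (2 - 2 q - V)\<close>, where \<open>V\<close> is the value of \<open>\<gamma>\<close> (\<open>wasserstein_le_primal\<close>).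
  A feasible pair \<open>(g, h)\<close> gives Kantorovich potentials, equal to \<open>1 - g\<close> on \<open>X\<close> and \<open>2 - h\<close>
  on \<open>Y\<close>, whose integral is the same expression with the value of \<open>(g, h)\<close> for \<open>V\<close>
  (\<open>wasserstein_ge_dual\<close>). Dividing by \<open>\<epsilon>\<close> and letting \<open>\<alpha> \<rightarrow> 1\<close> puts the surplus
  between every value of the maximisation and every value of the minimisation.

  It remains to see that the two linear programs have optimal solutions of equal value. This is
  linear programming duality, derived here from Farkas' lemma by way of a statement on
  skew-symmetric matrices (\<open>skew_symmetric_positive_entry\<close>), which yields existence of both optima
  and equality of their values at once.
\<close>

section \<open>Linear programming duality\<close>

text \<open>
  Induction on the number of constraints, following Bartl. If the last constraint \<open>k\<close> cannot be
  dropped, some \<open>x1\<close> satisfies the other ones but violates the conclusion. Projecting along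
  \<open>x1\<close> onto the hyperplane where constraint \<open>k\<close> vanishes eliminates \<open>k\<close>: the projected constraints
  still imply the projected conclusion. The multipliers of the projected system are kept,
  and the multiplier of \<open>k\<close> is what the projection took off; it is nonnegative by the choice
  of \<open>x1\<close>.
\<close>
lemma farkas:
  fixes A :: "'i \<Rightarrow> 'j \<Rightarrow> real" and c :: "'j \<Rightarrow> real"
  assumes "finite I" and "finite J"
    and "\<And>x. (\<forall>i\<in>I. (\<Sum>j\<in>J. A i j * x j) \<le> 0) \<Longrightarrow> (\<Sum>j\<in>J. c j * x j) \<le> 0"
  shows "\<exists>l. (\<forall>i\<in>I. 0 \<le> l i) \<and> (\<forall>j\<in>J. c j = (\<Sum>i\<in>I. l i * A i j))"
  using assms(1,3)
proof (induction I arbitrary: A c rule: finite_induct)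
  case empty
  \<comment> \<open>Without constraints, the conclusion may be tested at \<open>c\<close> itself.\<close>
  have "(\<Sum>j\<in>J. c j * c j) \<le> 0" using empty by simp
  then have "(\<Sum>j\<in>J. c j * c j) = 0" by (simp add: order_antisym sum_nonneg)
  then show ?case using \<open>finite J\<close> by (simp add: sum_nonneg_eq_0_iff)
next
  case (insert k I)
  define dot where "dot = (\<lambda>p x. \<Sum>j\<in>J. p j * x j :: real)"
  have dot: "dot p (\<lambda>j. x j + s * y j) = dot p x + s * dot p y"
       "dot (\<lambda>j. p j + s * q j) x = dot p x + s * dot q x" for p q x s y
    by (simp_all add: dot_def algebra_simps sum.distrib sum_distrib_left)
  have imp: "dot c x \<le> 0" if "dot (A k) x \<le> 0" "\<And>i. i \<in> I \<Longrightarrow> dot (A i) x \<le> 0" for x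
    using insert.prems[of x] that by (auto simp: dot_def)
  show ?case
  proof (cases "\<forall>x. (\<forall>i\<in>I. dot (A i) x \<le> 0) \<longrightarrow> dot c x \<le> 0")
    case True
    then obtain l where l: "\<forall>i\<in>I. 0 \<le> l i" "\<forall>j\<in>J. c j = (\<Sum>i\<in>I. l i * A i j)"
      using insert.IH[of A c] unfolding dot_def by blast
    show ?thesis
      by (rule exI[of _ "l(k := 0)"])
        (use l insert.hyps in \<open>auto intro!: sum.cong\<close>)
  next
    case False
    then obtain x1 where x1: "\<And>i. i \<in> I \<Longrightarrow> dot (A i) x1 \<le> 0" "dot c x1 > 0" by force
    have k1: "dot (A k) x1 > 0" using imp[of x1] x1 by force
    define s where "s i = dot (A i) x1 / dot (A k) x1" for i
    define sc where "sc = dot c x1 / dot (A k) x1"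
    have s: "s i \<le> 0" if "i \<in> I" for i
      using x1(1)[OF that] k1 by (simp add: s_def divide_nonpos_pos)
    have sc: "sc > 0" using x1 k1 by (simp add: sc_def)
    \<comment> \<open>Pull back the constraints and the conclusion along the projection
      \<open>x \<mapsto> x - (dot (A k) x / dot (A k) x1) x1\<close>.\<close>
    let ?A = "\<lambda>i j. A i j + (- s i) * A k j" and ?c = "\<lambda>j. c j + (- sc) * A k j"
    have "dot ?c x \<le> 0" if "\<And>i. i \<in> I \<Longrightarrow> dot (?A i) x \<le> 0" for x
    proof -
      define t where "t = - (dot (A k) x / dot (A k) x1)"
      have *: "dot p (\<lambda>j. x j + t * x1 j) = dot (\<lambda>j. p j + (- (dot p x1 / dot (A k) x1)) * A k j) x" for p
        unfolding dot t_def by simp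
      have "dot c (\<lambda>j. x j + t * x1 j) \<le> 0"
      proof (rule imp)
        show "dot (A k) (\<lambda>j. x j + t * x1 j) \<le> 0"
          unfolding dot using k1 by (simp add: t_def)
        show "dot (A i) (\<lambda>j. x j + t * x1 j) \<le> 0" if "i \<in> I" for i
          using \<open>\<And>i. i \<in> I \<Longrightarrow> dot (?A i) x \<le> 0\<close>[OF that] unfolding * s_def .
      qed
      then show ?thesis unfolding * sc_def .
    qed
    then obtain l where l: "\<And>i. i \<in> I \<Longrightarrow> 0 \<le> l i" "\<And>j. j \<in> J \<Longrightarrow> ?c j = (\<Sum>i\<in>I. l i * ?A i j)"
      using insert.IH[of ?A ?c] unfolding dot_def by blast
    define lk where "lk = sc - (\<Sum>i\<in>I. l i * s i)"
    have "(\<Sum>i\<in>I. l i * s i) \<le> 0"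
      by (rule sum_nonpos) (use l s in \<open>auto intro: mult_nonneg_nonpos\<close>)
    then have lk: "lk \<ge> 0" using sc by (simp add: lk_def)
    have "c j = lk * A k j + (\<Sum>i\<in>I. l i * A i j)" if "j \<in> J" for j
    proof -
      have "c j = sc * A k j + (\<Sum>i\<in>I. l i * (A i j + (- s i) * A k j))"
        using l(2)[OF that] by simp
      also have "\<dots> = lk * A k j + (\<Sum>i\<in>I. l i * A i j)"
        by (simp add: lk_def algebra_simps sum_subtractf sum_distrib_left)
      finally show ?thesis .
    qed
    moreover have "(\<Sum>i\<in>I. (l(k := lk)) i * A i j) = (\<Sum>i\<in>I. l i * A i j)" for j
      by (rule sum.cong) (use insert.hyps in auto)
    ultimately show ?thesis
      by (intro exI[of _ "l(k := lk)"]) (use lk l insert.hyps in auto)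
  qed
qed

text \<open>
  This is one coordinate of Tucker's theorem on skew-symmetric matrices. If \<open>z t > 0\<close>
  is impossible under \<open>z \<ge> 0\<close> and \<open>K z \<ge> 0\<close>, then these inequalities imply \<open>z t \<le> 0\<close>.
  By skew symmetry, the Farkas multipliers of the rows of \<open>K\<close> satisfy the same inequalities, and their image under \<open>K\<close> is
  at least 1 in coordinate \<open>t\<close>.
\<close>
lemma skew_symmetric_positive_entry:
  fixes K :: "'j \<Rightarrow> 'j \<Rightarrow> real"
  assumes "finite J" and t: "t \<in> J" and skew: "\<And>i j. i \<in> J \<Longrightarrow> j \<in> J \<Longrightarrow> K i j = - K j i"
  shows "\<exists>z. (\<forall>j\<in>J. 0 \<le> z j) \<and> (\<forall>i\<in>J. 0 \<le> (\<Sum>j\<in>J. K i j * z j)) \<and>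
             0 < z t + (\<Sum>j\<in>J. K t j * z j)"
proof (cases "\<exists>z. (\<forall>j\<in>J. 0 \<le> z j) \<and> (\<forall>i\<in>J. 0 \<le> (\<Sum>j\<in>J. K i j * z j)) \<and> 0 < z t")
  case True
  then obtain z where "\<forall>j\<in>J. 0 \<le> z j" "\<forall>i\<in>J. 0 \<le> (\<Sum>j\<in>J. K i j * z j)" "0 < z t" by blast
  then show ?thesis using t by (intro exI[of _ z] conjI add_pos_nonneg) auto
next
  case False
  define A where "A = case_sum (\<lambda>i j. if j = i then - 1 else (0 :: real)) (\<lambda>i j. - K i j)"
  define c where "c j = (if j = t then 1 else (0 :: real))" for j
  have A1: "(\<Sum>j\<in>J. A (Inl i) j * z j) = - z i" if "i \<in> J" for z i
  proof -
    have "(\<Sum>j\<in>J. A (Inl i) j * z j) = (\<Sum>j\<in>J. if j = i then - z j else 0)"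
      by (rule sum.cong) (auto simp: A_def)
    then show ?thesis using that \<open>finite J\<close> by simp
  qed
  have A2: "(\<Sum>j\<in>J. A (Inr i) j * z j) = - (\<Sum>j\<in>J. K i j * z j)" for z i
    by (simp add: A_def sum_negf)
  have cz: "(\<Sum>j\<in>J. c j * z j) = z t" for z
  proof -
    have "(\<Sum>j\<in>J. c j * z j) = (\<Sum>j\<in>J. if j = t then z j else 0)"
      by (rule sum.cong) (auto simp: c_def)
    then show ?thesis using t \<open>finite J\<close> by simp
  qed
  have "\<exists>l. (\<forall>i\<in>J <+> J. 0 \<le> l i) \<and> (\<forall>j\<in>J. c j = (\<Sum>i\<in>J <+> J. l i * A i j))"
  proof (rule farkas)
    fix z assume *: "\<forall>i\<in>J <+> J. (\<Sum>j\<in>J. A i j * z j) \<le> 0"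
    have "0 \<le> z i" if "i \<in> J" for i using *[THEN bspec, OF InlI[OF that]] A1[OF that] by simp
    moreover have "0 \<le> (\<Sum>j\<in>J. K i j * z j)" if "i \<in> J" for i
      using *[THEN bspec, OF InrI[OF that]] A2 by simp
    ultimately have "\<not> 0 < z t" using False by blast
    then show "(\<Sum>j\<in>J. c j * z j) \<le> 0" unfolding cz by simp
  qed (use \<open>finite J\<close> in auto)
  then obtain l where l': "\<forall>i\<in>J <+> J. 0 \<le> l i" "\<forall>j\<in>J. c j = (\<Sum>i\<in>J <+> J. l i * A i j)"
    by (elim exE conjE)
  note l = l'[THEN bspec]
  define z where "z i = l (Inr i)" for i
  have Kz: "(\<Sum>i\<in>J. K j i * z i) = c j + l (Inl j)" if "j \<in> J" for j
  proof -
    have "c j = (\<Sum>i\<in>J. l (Inl i) * A (Inl i) j) + (\<Sum>i\<in>J. l (Inr i) * A (Inr i) j)"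
      using l(2)[OF that] \<open>finite J\<close> by (simp add: sum.Plus)
    also have "(\<Sum>i\<in>J. l (Inl i) * A (Inl i) j) = (\<Sum>i\<in>J. if i = j then - l (Inl i) else 0)"
      by (rule sum.cong) (auto simp: A_def)
    also have "\<dots> = - l (Inl j)" using that \<open>finite J\<close> by simp
    also have "(\<Sum>i\<in>J. l (Inr i) * A (Inr i) j) = (\<Sum>i\<in>J. K j i * z i)"
    proof (rule sum.cong[OF refl])
      fix i assume "i \<in> J"
      show "l (Inr i) * A (Inr i) j = K j i * z i"
        using skew[OF that \<open>i \<in> J\<close>] by (simp add: A_def z_def)
    qed
    finally show ?thesis by simp
  qed
  have z: "0 \<le> z i" "0 \<le> l (Inl i)" if "i \<in> J" for i using l(1) that by (auto simp: z_def)
  show ?thesis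
  proof (intro exI[of _ z] conjI ballI)
    show "0 \<le> (\<Sum>j\<in>J. K i j * z j)" if "i \<in> J" for i
      using Kz[OF that] z[OF that] by (simp add: c_def)
    show "0 < z t + (\<Sum>j\<in>J. K t j * z j)"
      using Kz[OF t] z[OF t] by (simp add: c_def)
  qed (rule z)
qed

text \<open>
  The primal and the dual program, made homogeneous by one variable \<open>\<tau>\<close> and
  joined with the inequality between their values, form a skew-symmetric system; \<open>\<tau>\<close>
  is the distinguished coordinate of the preceding lemma. If \<open>\<tau> > 0\<close>, dividing by
  \<open>\<tau>\<close> gives the optima. The case \<open>\<tau> = 0\<close> would give a ray along which the gap between
  the values improves strictly, which weak duality against the given feasible points \<open>x0\<close> and \<open>y0\<close>
  excludes.
\<close>
lemma linear_programming_duality: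
  fixes A :: "'i \<Rightarrow> 'j \<Rightarrow> real" and b :: "'i \<Rightarrow> real" and c :: "'j \<Rightarrow> real"
  assumes fin: "finite I" "finite J"
    and x0: "\<And>j. j \<in> J \<Longrightarrow> 0 \<le> x0 j" "\<And>i. i \<in> I \<Longrightarrow> (\<Sum>j\<in>J. A i j * x0 j) \<le> b i"
    and y0: "\<And>i. i \<in> I \<Longrightarrow> 0 \<le> y0 i" "\<And>j. j \<in> J \<Longrightarrow> c j \<le> (\<Sum>i\<in>I. A i j * y0 i)"
  obtains x y where
    "\<And>j. j \<in> J \<Longrightarrow> 0 \<le> x j" "\<And>i. i \<in> I \<Longrightarrow> (\<Sum>j\<in>J. A i j * x j) \<le> b i"
    "\<And>i. i \<in> I \<Longrightarrow> 0 \<le> y i" "\<And>j. j \<in> J \<Longrightarrow> c j \<le> (\<Sum>i\<in>I. A i j * y i)"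
    "(\<Sum>i\<in>I. b i * y i) \<le> (\<Sum>j\<in>J. c j * x j)"
proof -
  \<comment> \<open>Rows: \<open>A\<^sup>T y \<ge> \<tau> c\<close>, then \<open>\<tau> b \<ge> A x\<close>, then \<open>c x \<ge> b y\<close>; columns: \<open>x\<close>, \<open>y\<close>, \<open>\<tau>\<close>.\<close>
  define K where "K = case_sum
     (case_sum (\<lambda>j. case_sum (case_sum (\<lambda>_. 0) (\<lambda>i. A i j)) (\<lambda>_. - c j))
               (\<lambda>i. case_sum (case_sum (\<lambda>j. - A i j) (\<lambda>_. 0)) (\<lambda>_. b i)))
     (\<lambda>_::unit. case_sum (case_sum c (\<lambda>i. - b i)) (\<lambda>_::unit. 0))"
  define S where "S = (J <+> I) <+> {()}"
  have "\<exists>z. (\<forall>j\<in>S. 0 \<le> z j) \<and> (\<forall>i\<in>S. 0 \<le> (\<Sum>j\<in>S. K i j * z j)) \<and>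
             0 < z (Inr ()) + (\<Sum>j\<in>S. K (Inr ()) j * z j)"
    by (rule skew_symmetric_positive_entry)
       (use fin in \<open>auto simp: S_def K_def split: sum.splits\<close>)
  then obtain z where z: "\<And>j. j \<in> S \<Longrightarrow> 0 \<le> z j"
    "\<And>i. i \<in> S \<Longrightarrow> 0 \<le> (\<Sum>j\<in>S. K i j * z j)"
    "0 < z (Inr ()) + (\<Sum>j\<in>S. K (Inr ()) j * z j)" by blast
  define x where "x j = z (Inl (Inl j))" for j
  define y where "y i = z (Inl (Inr i))" for i
  define \<tau> where "\<tau> = z (Inr ())"
  have sumS: "(\<Sum>j\<in>S. f j) = (\<Sum>j\<in>J. f (Inl (Inl j))) + (\<Sum>i\<in>I. f (Inl (Inr i))) + f (Inr ())"
    for f :: "('j + 'i) + unit \<Rightarrow> real"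
    using fin by (simp add: S_def sum.Plus)
  have inS: "j \<in> J \<Longrightarrow> Inl (Inl j) \<in> S" "i \<in> I \<Longrightarrow> Inl (Inr i) \<in> S" "Inr () \<in> S" for i j
    by (auto simp: S_def)
  have x: "0 \<le> x j" if "j \<in> J" for j unfolding x_def by (rule z) (use that in \<open>simp add: inS\<close>)
  have y: "0 \<le> y i" if "i \<in> I" for i unfolding y_def by (rule z) (use that in \<open>simp add: inS\<close>)
  have \<tau>: "0 \<le> \<tau>" unfolding \<tau>_def by (rule z) (simp add: inS)
  have Ax: "(\<Sum>j\<in>J. A i j * x j) \<le> \<tau> * b i" if "i \<in> I" for i
    using z(2)[of "Inl (Inr i)"] that unfolding sumS
    by (simp add: inS K_def x_def \<tau>_def sum_negf mult.commute)
  have Ay: "\<tau> * c j \<le> (\<Sum>i\<in>I. A i j * y i)" if "j \<in> J" for j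
    using z(2)[of "Inl (Inl j)"] that unfolding sumS
    by (simp add: inS K_def y_def \<tau>_def mult.commute)
  have gap: "(\<Sum>i\<in>I. b i * y i) \<le> (\<Sum>j\<in>J. c j * x j)"
    using z(2)[of "Inr ()"] unfolding sumS by (simp add: inS K_def x_def y_def sum_negf)
  have pos: "0 < \<tau> + ((\<Sum>j\<in>J. c j * x j) - (\<Sum>i\<in>I. b i * y i))"
    using z(3) unfolding sumS by (simp add: K_def x_def y_def \<tau>_def sum_negf)
  have swap: "(\<Sum>j\<in>J. (\<Sum>i\<in>I. A i j * q i) * p j) = (\<Sum>i\<in>I. (\<Sum>j\<in>J. A i j * p j) * q i)" for p q
    unfolding sum_distrib_right by (subst sum.swap) (simp add: mult_ac)
  have "\<tau> \<noteq> 0"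
  proof
    assume "\<tau> = 0"
    have "(\<Sum>j\<in>J. c j * x j) \<le> (\<Sum>j\<in>J. (\<Sum>i\<in>I. A i j * y0 i) * x j)"
      by (intro sum_mono mult_right_mono y0 x)
    also have "\<dots> = (\<Sum>i\<in>I. (\<Sum>j\<in>J. A i j * x j) * y0 i)" by (rule swap)
    also have "\<dots> \<le> 0"
      by (rule sum_nonpos) (use Ax y0 \<open>\<tau> = 0\<close> in \<open>auto intro: mult_nonpos_nonneg\<close>)
    finally have 1: "(\<Sum>j\<in>J. c j * x j) \<le> 0" .
    have "0 \<le> (\<Sum>j\<in>J. (\<Sum>i\<in>I. A i j * y i) * x0 j)"
      by (rule sum_nonneg) (use Ay x0 \<open>\<tau> = 0\<close> in auto)
    also have "\<dots> = (\<Sum>i\<in>I. (\<Sum>j\<in>J. A i j * x0 j) * y i)" by (rule swap)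
    also have "\<dots> \<le> (\<Sum>i\<in>I. b i * y i)"
      by (intro sum_mono mult_right_mono x0 y)
    finally show False using 1 pos \<open>\<tau> = 0\<close> by simp
  qed
  then have \<tau>: "\<tau> > 0" using \<tau> by simp
  show ?thesis
  proof (rule that[of "\<lambda>j. x j / \<tau>" "\<lambda>i. y i / \<tau>"])
    show "0 \<le> x j / \<tau>" if "j \<in> J" for j using x that \<tau> by simp
    show "0 \<le> y i / \<tau>" if "i \<in> I" for i using y that \<tau> by simp
    show "(\<Sum>j\<in>J. A i j * (x j / \<tau>)) \<le> b i" if "i \<in> I" for i
      using Ax[OF that] \<tau> by (simp add: sum_divide_distrib[symmetric] field_simps)
    show "c j \<le> (\<Sum>i\<in>I. A i j * (y i / \<tau>))" if "j \<in> J" for j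
      using Ay[OF that] \<tau> by (simp add: sum_divide_distrib[symmetric] field_simps)
    show "(\<Sum>i\<in>I. b i * (y i / \<tau>)) \<le> (\<Sum>j\<in>J. c j * (x j / \<tau>))"
      using gap \<tau> by (simp add: sum_divide_distrib[symmetric] divide_right_mono)
  qed
qed

text \<open>
  Both programs are feasible: \<open>\<gamma> = 0\<close> is a transport plan because \<open>a\<close> and \<open>b\<close> are nonnegative, and
  large \<open>g\<close> with \<open>h = 0\<close> satisfies the covering constraints.
\<close>
lemma partial_transport_duality:
  fixes c :: "'a \<Rightarrow> 'b \<Rightarrow> real" and a :: "'a \<Rightarrow> real" and b :: "'b \<Rightarrow> real"
  assumes fin: "finite X" "finite Y"
    and a: "\<And>u. u \<in> X \<Longrightarrow> 0 \<le> a u" and b: "\<And>v. v \<in> Y \<Longrightarrow> 0 \<le> b v"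
  shows "\<exists>\<gamma> g h.
    (\<forall>u\<in>X. \<forall>v\<in>Y. 0 \<le> \<gamma> u v) \<and>
    (\<forall>u\<in>X. (\<Sum>v\<in>Y. \<gamma> u v) \<le> a u) \<and> (\<forall>v\<in>Y. (\<Sum>u\<in>X. \<gamma> u v) \<le> b v) \<and>
    (\<forall>u\<in>X. 0 \<le> g u) \<and> (\<forall>v\<in>Y. 0 \<le> h v) \<and>
    (\<forall>u\<in>X. \<forall>v\<in>Y. c u v \<le> g u + h v) \<and>
    (\<Sum>u\<in>X. a u * g u) + (\<Sum>v\<in>Y. b v * h v) \<le> (\<Sum>u\<in>X. \<Sum>v\<in>Y. c u v * \<gamma> u v)"
proof -
  define A :: "'a + 'b \<Rightarrow> 'a \<times> 'b \<Rightarrow> real" where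
    "A = case_sum (\<lambda>u p. if fst p = u then 1 else 0) (\<lambda>v p. if snd p = v then 1 else 0)"
  have row: "(\<Sum>p\<in>X \<times> Y. A (Inl u) p * f p) = (\<Sum>v\<in>Y. f (u, v))" if "u \<in> X" for f u
  proof -
    have "(\<Sum>p\<in>X \<times> Y. A (Inl u) p * f p) = (\<Sum>u'\<in>X. \<Sum>v\<in>Y. if u' = u then f (u', v) else 0)"
      unfolding sum.cartesian_product by (auto simp: A_def intro!: sum.cong)
    also have "\<dots> = (\<Sum>v\<in>Y. \<Sum>u'\<in>X. if u' = u then f (u', v) else 0)" by (rule sum.swap)
    finally show ?thesis using fin that by simp
  qed
  have col: "(\<Sum>p\<in>X \<times> Y. A (Inr v) p * f p) = (\<Sum>u\<in>X. f (u, v))" if "v \<in> Y" for f v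
  proof -
    have "(\<Sum>p\<in>X \<times> Y. A (Inr v) p * f p) = (\<Sum>u\<in>X. \<Sum>v'\<in>Y. if v' = v then f (u, v') else 0)"
      unfolding sum.cartesian_product by (auto simp: A_def intro!: sum.cong)
    then show ?thesis using fin that by simp
  qed
  have dual: "(\<Sum>i\<in>X <+> Y. A i (u, v) * q i) = q (Inl u) + q (Inr v)" if "u \<in> X" "v \<in> Y" for q u v
  proof -
    have "(\<Sum>i\<in>X <+> Y. A i (u, v) * q i) =
        (\<Sum>u'\<in>X. if u' = u then q (Inl u') else 0) + (\<Sum>v'\<in>Y. if v' = v then q (Inr v') else 0)"
      unfolding sum.Plus[OF fin] by (auto simp: A_def intro!: arg_cong2[of _ _ _ _ plus] sum.cong)
    then show ?thesis using fin that by simp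
  qed
  obtain x y where x: "\<And>p. p \<in> X \<times> Y \<Longrightarrow> 0 \<le> x p"
      "\<And>i. i \<in> X <+> Y \<Longrightarrow> (\<Sum>p\<in>X \<times> Y. A i p * x p) \<le> case_sum a b i"
    and y: "\<And>i. i \<in> X <+> Y \<Longrightarrow> 0 \<le> y i"
      "\<And>p. p \<in> X \<times> Y \<Longrightarrow> case_prod c p \<le> (\<Sum>i\<in>X <+> Y. A i p * y i)"
    and gap: "(\<Sum>i\<in>X <+> Y. case_sum a b i * y i) \<le> (\<Sum>p\<in>X \<times> Y. case_prod c p * x p)"
  proof (rule linear_programming_duality[where I = "X <+> Y" and J = "X \<times> Y" and A = A
        and b = "case_sum a b" and c = "case_prod c" and ?x0.0 = "\<lambda>_. 0"
        and ?y0.0 = "case_sum (\<lambda>u. \<Sum>v\<in>Y. \<bar>c u v\<bar>) (\<lambda>_. 0)"])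
    show "case_prod c p \<le> (\<Sum>i\<in>X <+> Y. A i p * case_sum (\<lambda>u. \<Sum>v\<in>Y. \<bar>c u v\<bar>) (\<lambda>_. 0) i)"
      if "p \<in> X \<times> Y" for p
    proof -
      obtain u v where p: "p = (u, v)" "u \<in> X" "v \<in> Y" using \<open>p \<in> X \<times> Y\<close> by auto
      have "\<bar>c u v\<bar> \<le> (\<Sum>v\<in>Y. \<bar>c u v\<bar>)" by (rule member_le_sum) (use fin p in auto)
      then show ?thesis using p by (simp add: dual)
    qed
  qed (use fin a b in \<open>auto intro!: sum_nonneg\<close>)
  show ?thesis
  proof (rule exI[of _ "\<lambda>u v. x (u, v)"], rule exI[of _ "\<lambda>u. y (Inl u)"],
      rule exI[of _ "\<lambda>v. y (Inr v)"], intro conjI ballI)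
    show "(\<Sum>v\<in>Y. x (u, v)) \<le> a u" if "u \<in> X" for u
      using x(2)[OF InlI[OF that]] row[OF that] by simp
    show "(\<Sum>u\<in>X. x (u, v)) \<le> b v" if "v \<in> Y" for v
      using x(2)[OF InrI[OF that]] col[OF that] by simp
    show "c u v \<le> y (Inl u) + y (Inr v)" if "u \<in> X" "v \<in> Y" for u v
      using y(2)[of "(u, v)"] dual[OF that] that by simp
    show "(\<Sum>u\<in>X. a u * y (Inl u)) + (\<Sum>v\<in>Y. b v * y (Inr v)) \<le> (\<Sum>u\<in>X. \<Sum>v\<in>Y. c u v * x (u, v))"
      using gap by (simp add: sum.Plus fin sum.cartesian_product split_beta)
  qed (use x(1) y(1) in auto)
qed

section \<open>Bounding the Wasserstein distance from both sides\<close>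

lemma coupling_from_mass:
  fixes \<mu> \<nu> :: "'a pmf" and m :: "'a \<Rightarrow> 'a \<Rightarrow> real"
  assumes S: "finite S" "set_pmf \<mu> \<subseteq> S" "set_pmf \<nu> \<subseteq> S"
    and nonneg: "\<And>s t. s \<in> S \<Longrightarrow> t \<in> S \<Longrightarrow> 0 \<le> m s t"
    and row: "\<And>s. s \<in> S \<Longrightarrow> (\<Sum>t\<in>S. m s t) = pmf \<mu> s"
    and col: "\<And>t. t \<in> S \<Longrightarrow> (\<Sum>s\<in>S. m s t) = pmf \<nu> t"
  shows "\<exists>\<pi>\<in>couplings \<mu> \<nu>.
    \<forall>f. measure_pmf.expectation \<pi> (\<lambda>(s, t). f s t) = (\<Sum>s\<in>S. \<Sum>t\<in>S. f s t * m s t)"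
proof -
  define M where "M = (\<lambda>p. if p \<in> S \<times> S then m (fst p) (snd p) else 0)"
  define \<pi> where "\<pi> = embed_pmf M"
  have "(\<integral>\<^sup>+ p. ennreal (M p) \<partial>count_space UNIV) = (\<Sum>p\<in>S \<times> S. ennreal (M p))"
    by (rule nn_integral_count_space') (use S in \<open>auto simp: M_def\<close>)
  also have "\<dots> = ennreal (\<Sum>p\<in>S \<times> S. M p)"
    by (rule sum_ennreal) (auto simp: M_def nonneg)
  also have "(\<Sum>p\<in>S \<times> S. M p) = (\<Sum>s\<in>S. \<Sum>t\<in>S. m s t)"
    unfolding sum.cartesian_product by (rule sum.cong) (auto simp: M_def)
  also have "\<dots> = 1" using sum_pmf_eq_1[OF S(1,2)] by (simp add: row)
  finally have pmf: "pmf \<pi> p = M p" for p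
    unfolding \<pi>_def by (intro pmf_embed_pmf) (auto simp: M_def nonneg)
  have set: "set_pmf \<pi> \<subseteq> S \<times> S" by (auto simp: set_pmf_iff pmf M_def split: if_splits)
  have E: "measure_pmf.expectation \<pi> (\<lambda>(s, t). f s t) = (\<Sum>s\<in>S. \<Sum>t\<in>S. f s t * m s t)" for f
  proof -
    have "measure_pmf.expectation \<pi> (\<lambda>(s, t). f s t) = (\<Sum>p\<in>S \<times> S. (\<lambda>(s, t). f s t) p * pmf \<pi> p)"
      by (rule integral_measure_pmf_real) (use S set in auto)
    also have "\<dots> = (\<Sum>s\<in>S. \<Sum>t\<in>S. f s t * m s t)"
      unfolding sum.cartesian_product by (rule sum.cong) (auto simp: pmf M_def)
    finally show ?thesis .
  qed
  have "map_pmf fst \<pi> = \<mu>"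
  proof (rule pmf_eqI)
    fix z
    have "pmf (map_pmf fst \<pi>) z = measure_pmf.expectation \<pi> (\<lambda>(s, t). if s = z then 1 else 0)"
    proof -
      have *: "(\<lambda>(s, t). if s = z then 1 else 0) = indicat_real (fst -` {z})"
        by (auto simp: fun_eq_iff indicator_def)
      show ?thesis unfolding * by (simp add: pmf_map)
    qed
    also have "\<dots> = (\<Sum>s\<in>S. if s = z then \<Sum>t\<in>S. m s t else 0)"
      unfolding E by (rule sum.cong) auto
    also have "\<dots> = pmf \<mu> z"
      using S by (auto simp: row set_pmf_iff subset_iff)
    finally show "pmf (map_pmf fst \<pi>) z = pmf \<mu> z" .
  qed
  moreover have "map_pmf snd \<pi> = \<nu>"
  proof (rule pmf_eqI)
    fix z
    have "pmf (map_pmf snd \<pi>) z = measure_pmf.expectation \<pi> (\<lambda>(s, t). if t = z then 1 else 0)"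
    proof -
      have *: "(\<lambda>(s, t). if t = z then 1 else 0) = indicat_real (snd -` {z})"
        by (auto simp: fun_eq_iff indicator_def)
      show ?thesis unfolding * by (simp add: pmf_map)
    qed
    also have "\<dots> = (\<Sum>t\<in>S. \<Sum>s\<in>S. if t = z then m s t else 0)"
      unfolding E by (subst sum.swap) (auto intro!: sum.cong)
    also have "\<dots> = (\<Sum>t\<in>S. if t = z then \<Sum>s\<in>S. m s t else 0)"
      by (rule sum.cong) auto
    also have "\<dots> = pmf \<nu> z"
      using S by (auto simp: col set_pmf_iff subset_iff)
    finally show "pmf (map_pmf snd \<pi>) z = pmf \<nu> z" .
  qed
  ultimately show ?thesis using E by (auto simp: couplings_def)
qed

text \<open>
  The easy half of Kantorovich duality: integrate the pointwise inequality against a coupling,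
  which lives on the product of the supports.
\<close>
lemma wasserstein1_ge_potentials:
  fixes \<mu> \<nu> :: "'a pmf" and f g :: "'a \<Rightarrow> real"
  assumes S: "finite S" "set_pmf \<mu> \<subseteq> S" "set_pmf \<nu> \<subseteq> S"
    and le: "\<And>s t. s \<in> set_pmf \<mu> \<Longrightarrow> t \<in> set_pmf \<nu> \<Longrightarrow> f s + g t \<le> d s t"
  shows "(\<Sum>s\<in>S. f s * pmf \<mu> s) + (\<Sum>t\<in>S. g t * pmf \<nu> t) \<le> wasserstein1 d \<mu> \<nu>"
  unfolding wasserstein1_def
proof (rule cINF_greatest)
  show "couplings \<mu> \<nu> \<noteq> {}" using pair_pmf_coupling by blast
  fix \<pi> assume \<pi>: "\<pi> \<in> couplings \<mu> \<nu>"
  have fin: "finite (set_pmf \<pi>)"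
    by (rule finite_subset[OF set_pmf_coupling[OF \<pi>]]) (use S finite_subset in blast)
  have "(\<Sum>s\<in>S. f s * pmf \<mu> s) = measure_pmf.expectation \<mu> f"
    by (rule integral_measure_pmf_real[symmetric]) (use S in auto)
  also have "\<dots> = measure_pmf.expectation \<pi> (\<lambda>p. f (fst p))"
    using \<pi> by (auto simp: couplings_def simp flip: integral_map_pmf)
  finally have 1: "(\<Sum>s\<in>S. f s * pmf \<mu> s) = measure_pmf.expectation \<pi> (\<lambda>p. f (fst p))" .
  have "(\<Sum>t\<in>S. g t * pmf \<nu> t) = measure_pmf.expectation \<nu> g"
    by (rule integral_measure_pmf_real[symmetric]) (use S in auto)
  also have "\<dots> = measure_pmf.expectation \<pi> (\<lambda>p. g (snd p))"
    using \<pi> by (auto simp: couplings_def simp flip: integral_map_pmf)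
  finally have 2: "(\<Sum>t\<in>S. g t * pmf \<nu> t) = measure_pmf.expectation \<pi> (\<lambda>p. g (snd p))" .
  have "measure_pmf.expectation \<pi> (\<lambda>p. f (fst p) + g (snd p)) \<le> measure_pmf.expectation \<pi> (\<lambda>(s, t). d s t)"
    by (rule integral_mono_AE)
       (use set_pmf_coupling[OF \<pi>] le fin in
         \<open>auto intro!: integrable_measure_pmf_finite simp: AE_measure_pmf_iff\<close>)
  then show "(\<Sum>s\<in>S. f s * pmf \<mu> s) + (\<Sum>t\<in>S. g t * pmf \<nu> t) \<le> measure_pmf.expectation \<pi> (\<lambda>(s, t). d s t)"
    unfolding 1 2 using fin by (simp add: integrable_measure_pmf_finite)
qed

section \<open>Distances around an edge on no triangle\<close>

context pair_graph
begin

lemma sym_arc: "(u, v) \<in> parcs G \<Longrightarrow> (v, u) \<in> parcs G"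
  using pair_sym_arcs by (auto simp: symmetric_def dest: symD)

lemma graph_dist_self:
  assumes "u \<in> pverts G"
  shows "graph_dist G u u = 0"
proof -
  have "\<mu> (\<lambda>_. 1) u u \<le> ereal (awalk_cost (\<lambda>_. 1) [])"
    by (rule min_cost_le_walk_cost) (use assms in \<open>auto simp: awalk_def\<close>)
  then have "graph_dist G u u \<le> 0"
    unfolding graph_dist_def by (cases "\<mu> (\<lambda>_. 1) u u") (auto simp: zero_ereal_def)
  then show ?thesis using graph_dist_nonneg[of u u] by simp
qed

lemma graph_dist_two:
  assumes uv: "(u, v) \<in> parcs G" and vz: "(v, z) \<in> parcs G"
    and "u \<noteq> z" and "(u, z) \<notin> parcs G"
  shows "graph_dist G u z = 2"
proof -
  have "\<mu> (\<lambda>_. 1) u z \<le> ereal (awalk_cost (\<lambda>_. 1) [(u, v), (v, z)])"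
    by (rule min_cost_le_walk_cost)
       (use assms in_arcsD1 in_arcsD2 in \<open>auto simp: awalk_def\<close>)
  moreover have "2 \<le> \<mu> (\<lambda>_. 1) u z"
    unfolding \<mu>_def
  proof (rule INF_greatest)
    fix p assume "p \<in> {p. awalk u p z}"
    then have p: "awalk u p z" by simp
    obtain e f q where "p = e # f # q"
    \<comment> \<open>A walk of length 0 or 1 is excluded because \<open>u\<close> and \<open>z\<close> are distinct and not adjacent.\<close>
    proof (cases p rule: remdups_adj.cases)
      case 1
      then show ?thesis using p assms by (auto simp: awalk_def)
    next
      case (2 e)
      then show ?thesis using p assms by (cases e) (auto simp: awalk_def)
    qed
    moreover have "0 \<le> awalk_cost (\<lambda>_. 1) q" by (auto simp: awalk_cost_def intro!: sum_list_nonneg)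
    ultimately show "2 \<le> ereal (awalk_cost (\<lambda>_. 1) p)"
      by (simp add: awalk_cost_def)
  qed
  ultimately have "\<mu> (\<lambda>_. 1) u z = 2" by (simp add: awalk_cost_def)
  then show ?thesis by (simp add: graph_dist_def)
qed

lemma local_girth_triangle:
  assumes e: "(x, y) \<in> parcs G" and xu: "(x, u) \<in> parcs G" and yu: "(y, u) \<in> parcs G"
  shows "local_girth G x y \<le> 3"
proof -
  let ?p = "[(x, y), (y, u), (u, x)]"
  have "x \<noteq> y" "x \<noteq> u" "y \<noteq> u" using assms by (auto dest: pair_no_loops)
  then have "cycle ?p"
    unfolding cycle_def
    by (intro exI[of _ x]) (use assms sym_arc in_arcsD1 in_arcsD2 in \<open>auto simp: awalk_def\<close>)
  then have "local_girth G x y \<le> enat (length ?p)"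
    unfolding local_girth_def by (intro INF_lower) simp
  then show ?thesis by (simp add: numeral_eq_enat numeral_3_eq_3)
qed

end

locale triangle_free_edge = pair_graph G for G :: "'a pair_pre_digraph" +
  fixes w :: "'a set \<Rightarrow> real" and x y :: 'a
  assumes weight: "pos_weight G w" and edge: "(x, y) \<in> parcs G"
    and no_common_nbr: "nbrs G x \<inter> nbrs G y = {}"
begin

definition "X = nbrs G x - {y}"
definition "Y = nbrs G y - {x}"
definition "a u = w {x, u} / wdeg G w x"
definition "b v = w {y, v} / wdeg G w y"
definition "d = graph_dist G"

lemma edge_rev: "(y, x) \<in> parcs G"
  using edge by (rule sym_arc)

lemma neq: "x \<noteq> y" "y \<noteq> x"
  using edge by (auto dest: pair_no_loops)

lemma finite_XY [simp]: "finite X" "finite Y"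
  by (simp_all add: X_def Y_def finite_nbrs)

lemma X_notin: "x \<notin> X" "y \<notin> X" "x \<notin> Y" "y \<notin> Y"
  using not_in_nbrs by (auto simp: X_def Y_def)

lemma XY_disjoint: "X \<inter> Y = {}"
  using no_common_nbr by (auto simp: X_def Y_def)

lemma nbrs_eq: "nbrs G x = insert y X" "nbrs G y = insert x Y"
  using edge edge_rev by (auto simp: X_def Y_def nbrs_def)

lemma distances:
  "d x x = 0" "d y y = 0" "d x y = 1" "d y x = 1"
  "u \<in> X \<Longrightarrow> d u x = 1" "u \<in> X \<Longrightarrow> d u y = 2" "v \<in> Y \<Longrightarrow> d x v = 2" "v \<in> Y \<Longrightarrow> d y v = 1"
proof -
  show "d x x = 0" "d y y = 0" "d x y = 1" "d y x = 1"
    using edge edge_rev by (auto simp: d_def graph_dist_edge intro!: graph_dist_self dest: in_arcsD1 in_arcsD2)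
  show "d u x = 1" "d u y = 2" if "u \<in> X"
  proof -
    have u: "(u, x) \<in> parcs G" "u \<noteq> y" using that by (auto simp: X_def nbrs_def intro: sym_arc)
    have "(u, y) \<notin> parcs G" using that no_common_nbr sym_arc[of u y] by (auto simp: X_def nbrs_def)
    then show "d u x = 1" "d u y = 2"
      using u edge by (auto simp: d_def graph_dist_edge intro: graph_dist_two)
  qed
  show "d x v = 2" "d y v = 1" if "v \<in> Y"
  proof -
    have v: "(y, v) \<in> parcs G" "x \<noteq> v" using that by (auto simp: Y_def nbrs_def)
    have "(x, v) \<notin> parcs G" using that no_common_nbr by (auto simp: Y_def nbrs_def)
    then show "d x v = 2" "d y v = 1"
      using v edge by (auto simp: d_def graph_dist_edge intro: graph_dist_two)
  qed
qed

lemma wdegs: "wdeg G w x > 0" "wdeg G w y > 0"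
  using wdeg_pos[OF weight edge] wdeg_pos[OF weight edge_rev] .

lemma total_mass: "a y + (\<Sum>u\<in>X. a u) = 1" "b x + (\<Sum>v\<in>Y. b v) = 1"
proof -
  have "a y + (\<Sum>u\<in>X. a u) = (\<Sum>u\<in>nbrs G x. a u)" using X_notin by (simp add: nbrs_eq)
  also have "\<dots> = 1" using wdegs by (simp add: a_def sum_divide_distrib[symmetric] wdeg_def[symmetric])
  finally show "a y + (\<Sum>u\<in>X. a u) = 1" .
  have "b x + (\<Sum>v\<in>Y. b v) = (\<Sum>v\<in>nbrs G y. b v)" using X_notin by (simp add: nbrs_eq)
  also have "\<dots> = 1" using wdegs by (simp add: b_def sum_divide_distrib[symmetric] wdeg_def[symmetric])
  finally show "b x + (\<Sum>v\<in>Y. b v) = 1" .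
qed

lemma ab_nonneg:
  "0 \<le> a y" "0 \<le> b x" "u \<in> X \<Longrightarrow> 0 \<le> a u" "v \<in> Y \<Longrightarrow> 0 \<le> b v"
proof -
  have "0 \<le> a u" if "u \<in> nbrs G x" for u
    using that weight wdegs by (force simp: a_def pos_weight_def nbrs_def intro!: divide_nonneg_pos)
  then show "0 \<le> a y" "u \<in> X \<Longrightarrow> 0 \<le> a u" by (auto simp: nbrs_eq)
  have "0 \<le> b v" if "v \<in> nbrs G y" for v
    using that weight wdegs by (force simp: b_def pos_weight_def nbrs_def intro!: divide_nonneg_pos)
  then show "0 \<le> b x" "v \<in> Y \<Longrightarrow> 0 \<le> b v" by (auto simp: nbrs_eq)
qed

lemma edge_q_eq: "edge_q G w x y = a y + b x"
  by (simp add: edge_q_def a_def b_def insert_commute)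

definition "S = insert x (insert y (X \<union> Y))"

lemma finite_S: "finite S" by (simp add: S_def)

lemma sum_S: "(\<Sum>s\<in>S. f s) = f x + f y + (\<Sum>u\<in>X. f u) + (\<Sum>v\<in>Y. f v)"
  for f :: "'a \<Rightarrow> real"
  using neq X_notin XY_disjoint by (simp add: S_def sum.union_disjoint)

section \<open>The surplus between the two linear programs\<close>

context
  fixes \<alpha> :: real
  assumes \<alpha>: "0 \<le> \<alpha>" "\<alpha> \<le> 1"
begin

abbreviation "\<mu>x \<equiv> lly_measure G w \<alpha> x"
abbreviation "\<mu>y \<equiv> lly_measure G w \<alpha> y"

lemma pmf_\<mu>x: "pmf \<mu>x x = \<alpha>" "pmf \<mu>x y = (1 - \<alpha>) * a y"
    "u \<in> X \<Longrightarrow> pmf \<mu>x u = (1 - \<alpha>) * a u" "v \<in> Y \<Longrightarrow> pmf \<mu>x v = 0"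
  unfolding pmf_lly_measure[OF weight edge \<alpha>]
  using neq X_notin XY_disjoint by (auto simp: lly_mass_def nbrs_eq a_def)

lemma pmf_\<mu>y: "pmf \<mu>y y = \<alpha>" "pmf \<mu>y x = (1 - \<alpha>) * b x"
    "v \<in> Y \<Longrightarrow> pmf \<mu>y v = (1 - \<alpha>) * b v" "u \<in> X \<Longrightarrow> pmf \<mu>y u = 0"
  unfolding pmf_lly_measure[OF weight edge_rev \<alpha>]
  using neq X_notin XY_disjoint by (auto simp: lly_mass_def nbrs_eq b_def)

lemma set_\<mu>: "set_pmf \<mu>x \<subseteq> insert x (insert y X)" "set_pmf \<mu>y \<subseteq> insert x (insert y Y)"
  unfolding set_pmf_iff subset_iff pmf_lly_measure[OF weight edge \<alpha>] pmf_lly_measure[OF weight edge_rev \<alpha>]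
  by (auto simp: lly_mass_def nbrs_eq split: if_splits)

lemma wasserstein_ge_dual:
  assumes g: "\<And>u. u \<in> X \<Longrightarrow> 0 \<le> g u" and h: "\<And>v. v \<in> Y \<Longrightarrow> 0 \<le> h v"
    and gh: "\<And>u v. u \<in> X \<Longrightarrow> v \<in> Y \<Longrightarrow> 3 - d u v \<le> g u + h v"
  shows "1 + (1 - \<alpha>) * (2 - 2 * (a y + b x) - ((\<Sum>u\<in>X. a u * g u) + (\<Sum>v\<in>Y. b v * h v)))
    \<le> wasserstein1 d \<mu>x \<mu>y"
proof -
  \<comment> \<open>The potentials are tight on the moves \<open>x \<rightarrow> x\<close>, \<open>y \<rightarrow> y\<close> and \<open>x \<rightarrow> y\<close>, and \<open>g\<close> and \<open>h\<close> are
    the slacks of \<open>u \<rightarrow> y\<close> and \<open>x \<rightarrow> v\<close>. The move \<open>u \<rightarrow> v\<close> then asks for exactly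
    \<open>3 - g u - h v \<le> d u v\<close>.\<close>
  define f where "f s = (if s = x then 0 else if s = y then - 1 else 1 - g s)" for s
  define k where "k t = (if t = x then 0 else if t = y then 1 else 2 - h t)" for t
  have f: "f x = 0" "f y = - 1" "u \<in> X \<Longrightarrow> f u = 1 - g u" for u
    using neq X_notin by (auto simp: f_def)
  have k: "k x = 0" "k y = 1" "v \<in> Y \<Longrightarrow> k v = 2 - h v" for v
    using neq X_notin by (auto simp: k_def)
  have "(\<Sum>s\<in>S. f s * pmf \<mu>x s) + (\<Sum>t\<in>S. k t * pmf \<mu>y t) \<le> wasserstein1 d \<mu>x \<mu>y"
  proof (rule wasserstein1_ge_potentials[OF finite_S])
    show "set_pmf \<mu>x \<subseteq> S" "set_pmf \<mu>y \<subseteq> S" using set_\<mu> by (auto simp: S_def)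
    fix s t assume "s \<in> set_pmf \<mu>x" "t \<in> set_pmf \<mu>y"
    then have "s = x \<or> s = y \<or> s \<in> X" "t = x \<or> t = y \<or> t \<in> Y" using set_\<mu> by auto
    then show "f s + k t \<le> d s t"
      using g h gh by (elim disjE) (fastforce simp: f k distances)+
  qed
  also have "(\<Sum>s\<in>S. f s * pmf \<mu>x s) = - (1 - \<alpha>) * a y + (\<Sum>u\<in>X. (1 - \<alpha>) * (a u - a u * g u))"
    unfolding sum_S by (simp add: f pmf_\<mu>x algebra_simps cong: sum.cong)
  also have "(\<Sum>u\<in>X. (1 - \<alpha>) * (a u - a u * g u)) = (1 - \<alpha>) * (1 - a y - (\<Sum>u\<in>X. a u * g u))"
    using total_mass by (simp add: sum_subtractf sum_distrib_left[symmetric])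
  also have "(\<Sum>t\<in>S. k t * pmf \<mu>y t) = \<alpha> + (\<Sum>v\<in>Y. (1 - \<alpha>) * (2 * b v - b v * h v))"
    unfolding sum_S by (simp add: k pmf_\<mu>y algebra_simps cong: sum.cong)
  also have "(\<Sum>v\<in>Y. (1 - \<alpha>) * (2 * b v - b v * h v)) = (1 - \<alpha>) * (2 * (1 - b x) - (\<Sum>v\<in>Y. b v * h v))"
    using total_mass by (simp add: sum_subtractf sum_distrib_left[symmetric])
  finally show ?thesis by (simp add: algebra_simps)
qed

text \<open>
  The direct moves carry \<open>\<epsilon> T\<close> in total, \<open>T\<close> being the mass of \<open>\<gamma>\<close> and \<open>\<epsilon> = 1 - \<alpha>\<close>.
  A unit moved from \<open>u\<close> to \<open>v\<close> replaces a move \<open>u \<rightarrow> y\<close> of cost 2 and a move \<open>x \<rightarrow> v\<close> of cost 2, and adds a unit to the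
  move \<open>x \<rightarrow> y\<close> of cost 1: this is where \<open>3 = 2 + 2 - 1\<close> comes from. The bound
  on \<open>\<alpha>\<close> leaves enough mass at \<open>x\<close> for the move \<open>x \<rightarrow> y\<close>.
\<close>
lemma wasserstein_le_primal:
  assumes half: "1 / 2 \<le> \<alpha>"
    and \<gamma>: "\<And>u v. u \<in> X \<Longrightarrow> v \<in> Y \<Longrightarrow> 0 \<le> \<gamma> u v"
    and row: "\<And>u. u \<in> X \<Longrightarrow> (\<Sum>v\<in>Y. \<gamma> u v) \<le> a u"
    and col: "\<And>v. v \<in> Y \<Longrightarrow> (\<Sum>u\<in>X. \<gamma> u v) \<le> b v"
  shows "wasserstein1 d \<mu>x \<mu>y
    \<le> 1 + (1 - \<alpha>) * (2 - 2 * (a y + b x) - (\<Sum>u\<in>X. \<Sum>v\<in>Y. (3 - d u v) * \<gamma> u v))"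
proof -
  define R where "R u = (\<Sum>v\<in>Y. \<gamma> u v)" for u
  define C where "C v = (\<Sum>u\<in>X. \<gamma> u v)" for v
  define T where "T = (\<Sum>u\<in>X. R u)"
  have T: "(\<Sum>v\<in>Y. C v) = T" unfolding T_def R_def C_def by (rule sum.swap)
  have "0 \<le> T" unfolding T_def R_def by (intro sum_nonneg \<gamma>)
  \<comment> \<open>The last summand is the move \<open>x \<rightarrow> y\<close>; its amount is forced by the mass of \<open>x\<close>.\<close>
  define m where "m s t = (1 - \<alpha>) *
     (if s \<in> X \<and> t \<in> Y then \<gamma> s t
      else if s \<in> X \<and> t = y then a s - R s
      else if s = x \<and> t \<in> Y then b t - C t
      else if s = y \<and> t = y then a y
      else if s = x \<and> t = x then b x
      else 0) + (if s = x \<and> t = y then \<alpha> - (1 - \<alpha>) * (1 - T) else 0)" for s t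
  have XY: "v \<in> Y \<Longrightarrow> v \<notin> X" for v using XY_disjoint by auto
  have ne: "u \<in> X \<Longrightarrow> u \<noteq> x \<and> u \<noteq> y" "v \<in> Y \<Longrightarrow> v \<noteq> x \<and> v \<noteq> y" for u v using X_notin by auto
  have mx: "m x x = (1 - \<alpha>) * b x" "m x y = \<alpha> - (1 - \<alpha>) * (1 - T)"
      "u \<in> X \<Longrightarrow> m x u = 0" "v \<in> Y \<Longrightarrow> m x v = (1 - \<alpha>) * (b v - C v)" for u v
    using neq X_notin XY ne by (auto simp: m_def)
  have my: "m y x = 0" "m y y = (1 - \<alpha>) * a y"
      "u \<in> X \<Longrightarrow> m y u = 0" "v \<in> Y \<Longrightarrow> m y v = 0" for u v
    using neq X_notin XY ne by (auto simp: m_def)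
  have mX: "m u x = 0" "m u y = (1 - \<alpha>) * (a u - R u)"
      "u' \<in> X \<Longrightarrow> m u u' = 0" "v \<in> Y \<Longrightarrow> m u v = (1 - \<alpha>) * \<gamma> u v" if "u \<in> X" for u u' v
    using that neq X_notin XY ne by (auto simp: m_def)
  have mY: "m v t = 0" if "v \<in> Y" for v t
    using that neq X_notin XY ne by (auto simp: m_def)
  have sums: "(\<Sum>u\<in>X. (1 - \<alpha>) * (a u - R u)) = (1 - \<alpha>) * (1 - a y - T)"
    "(\<Sum>v\<in>Y. (1 - \<alpha>) * (b v - C v)) = (1 - \<alpha>) * (1 - b x - T)"
    using total_mass T by (simp_all add: sum_distrib_left[symmetric] sum_subtractf T_def)
  have "\<exists>\<pi>\<in>couplings \<mu>x \<mu>y.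
    \<forall>f. measure_pmf.expectation \<pi> (\<lambda>(s, t). f s t) = (\<Sum>s\<in>S. \<Sum>t\<in>S. f s t * m s t)"
  proof (rule coupling_from_mass[OF finite_S])
    show "set_pmf \<mu>x \<subseteq> S" "set_pmf \<mu>y \<subseteq> S" using set_\<mu> by (auto simp: S_def)
    show "0 \<le> m s t" for s t
    proof -
      have "(1 - \<alpha>) * (1 - T) \<le> (1 - \<alpha>) * 1"
        using \<alpha> \<open>0 \<le> T\<close> by (intro mult_left_mono) auto
      then have "0 \<le> \<alpha> - (1 - \<alpha>) * (1 - T)" using half by simp
      then show ?thesis
        using \<alpha> \<gamma> row col ab_nonneg by (auto simp: m_def R_def C_def intro!: add_nonneg_nonneg mult_nonneg_nonneg)
    qed
    show "(\<Sum>t\<in>S. m s t) = pmf \<mu>x s" if s: "s \<in> S" for s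
    proof -
      consider "s = x" | "s = y" | "s \<in> X" | "s \<in> Y" using s by (auto simp: S_def)
      then show ?thesis
      proof cases
        case 1
        then have "(\<Sum>t\<in>S. m s t) = (1 - \<alpha>) * b x + (\<alpha> - (1 - \<alpha>) * (1 - T)) + (1 - \<alpha>) * (1 - b x - T)"
          by (simp add: sum_S mx sums cong: sum.cong)
        then show ?thesis using 1 by (simp add: pmf_\<mu>x algebra_simps)
      next
        case 3
        have "(\<Sum>v\<in>Y. (1 - \<alpha>) * \<gamma> s v) = (1 - \<alpha>) * R s" by (simp add: R_def sum_distrib_left)
        then have "(\<Sum>t\<in>S. m s t) = (1 - \<alpha>) * (a s - R s) + (1 - \<alpha>) * R s"
          using 3 by (simp add: sum_S mX cong: sum.cong)
        then show ?thesis using 3 by (simp add: pmf_\<mu>x algebra_simps)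
      qed (simp_all add: sum_S my mY pmf_\<mu>x cong: sum.cong)
    qed
    show "(\<Sum>s\<in>S. m s t) = pmf \<mu>y t" if t: "t \<in> S" for t
    proof -
      consider "t = x" | "t = y" | "t \<in> X" | "t \<in> Y" using t by (auto simp: S_def)
      then show ?thesis
      proof cases
        case 2
        then have "(\<Sum>s\<in>S. m s t) = (\<alpha> - (1 - \<alpha>) * (1 - T)) + (1 - \<alpha>) * a y + (1 - \<alpha>) * (1 - a y - T)"
          by (simp add: sum_S mx my mX mY sums cong: sum.cong)
        then show ?thesis using 2 by (simp add: pmf_\<mu>y algebra_simps)
      next
        case 4
        have "(\<Sum>u\<in>X. (1 - \<alpha>) * \<gamma> u t) = (1 - \<alpha>) * C t" by (simp add: C_def sum_distrib_left)
        then have "(\<Sum>s\<in>S. m s t) = (1 - \<alpha>) * (b t - C t) + (1 - \<alpha>) * C t"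
          using 4 by (simp add: sum_S mx my mX mY cong: sum.cong)
        then show ?thesis using 4 by (simp add: pmf_\<mu>y algebra_simps)
      qed (simp_all add: sum_S mx my mX mY pmf_\<mu>y cong: sum.cong)
    qed
  qed
  then obtain \<pi> where \<pi>: "\<pi> \<in> couplings \<mu>x \<mu>y"
    "\<And>f. measure_pmf.expectation \<pi> (\<lambda>(s, t). f s t) = (\<Sum>s\<in>S. \<Sum>t\<in>S. f s t * m s t)"
    by blast
  have "wasserstein1 d \<mu>x \<mu>y \<le> (\<Sum>s\<in>S. \<Sum>t\<in>S. d s t * m s t)"
    unfolding \<pi>(2)[symmetric] by (rule wasserstein1_le[OF _ \<pi>(1)]) (simp add: d_def graph_dist_nonneg)
  also have "\<dots> = (\<Sum>t\<in>S. d x t * m x t) + (\<Sum>t\<in>S. d y t * m y t) + (\<Sum>u\<in>X. \<Sum>t\<in>S. d u t * m u t)"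
    by (simp add: sum_S[of "\<lambda>s. \<Sum>t\<in>S. d s t * m s t"] mY cong: sum.cong)
  also have "(\<Sum>t\<in>S. d y t * m y t) = 0"
    by (simp add: sum_S my distances cong: sum.cong)
  also have "(\<Sum>t\<in>S. d x t * m x t) = \<alpha> - (1 - \<alpha>) * (1 - T) + 2 * (\<Sum>v\<in>Y. (1 - \<alpha>) * (b v - C v))"
    unfolding sum_distrib_left by (simp add: sum_S mx distances mult_ac cong: sum.cong)
  also have "(\<Sum>u\<in>X. \<Sum>t\<in>S. d u t * m u t) =
      (\<Sum>u\<in>X. 2 * ((1 - \<alpha>) * (a u - R u)) + (1 - \<alpha>) * (\<Sum>v\<in>Y. d u v * \<gamma> u v))"
    by (rule sum.cong) (simp_all add: sum_S mX distances sum_distrib_left mult_ac cong: sum.cong)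
  also have "\<dots> = 2 * (\<Sum>u\<in>X. (1 - \<alpha>) * (a u - R u)) + (1 - \<alpha>) * (\<Sum>u\<in>X. \<Sum>v\<in>Y. d u v * \<gamma> u v)"
    by (simp add: sum.distrib sum_distrib_left)
  also have "(\<Sum>u\<in>X. \<Sum>v\<in>Y. d u v * \<gamma> u v) = 3 * T - (\<Sum>u\<in>X. \<Sum>v\<in>Y. (3 - d u v) * \<gamma> u v)"
    by (simp add: T_def R_def sum_subtractf left_diff_distrib sum_distrib_left)
  finally show ?thesis unfolding sums by (simp add: algebra_simps)
qed

end

lemma primal_le_surplus:
  assumes "\<And>u v. u \<in> X \<Longrightarrow> v \<in> Y \<Longrightarrow> 0 \<le> \<gamma> u v"
    and "\<And>u. u \<in> X \<Longrightarrow> (\<Sum>v\<in>Y. \<gamma> u v) \<le> a u"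
    and "\<And>v. v \<in> Y \<Longrightarrow> (\<Sum>u\<in>X. \<gamma> u v) \<le> b v"
  shows "(\<Sum>u\<in>X. \<Sum>v\<in>Y. (3 - graph_dist G u v) * \<gamma> u v) \<le> short_cycle_surplus G w x y"
proof -
  define V where "V = (\<Sum>u\<in>X. \<Sum>v\<in>Y. (3 - d u v) * \<gamma> u v)"
  have "2 * (a y + b x) - 2 + V \<le> lly_curvature G w x y"
  proof (rule tendsto_lowerbound[OF lly_curvature_tendsto[OF weight edge]])
    have "\<forall>\<^sub>F \<alpha> in at_left 1. \<alpha> \<in> {1 / 2 <..< 1 :: real}"
      by (rule eventually_at_left_real) simp
    then show "\<forall>\<^sub>F \<alpha> in at_left 1. 2 * (a y + b x) - 2 + V \<le> alpha_curvature G w \<alpha> x y / (1 - \<alpha>)"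
    proof eventually_elim
      case (elim \<alpha>)
      have "wasserstein1 d (lly_measure G w \<alpha> x) (lly_measure G w \<alpha> y)
          \<le> 1 + (1 - \<alpha>) * (2 - 2 * (a y + b x) - V)"
        unfolding V_def by (rule wasserstein_le_primal) (use elim assms in auto)
      then have "(2 * (a y + b x) - 2 + V) * (1 - \<alpha>) \<le> alpha_curvature G w \<alpha> x y"
        by (simp add: alpha_curvature_def d_def algebra_simps)
      then show ?case using elim by (simp add: pos_le_divide_eq)
    qed
  qed simp
  then show ?thesis by (simp add: short_cycle_surplus_def edge_q_eq V_def d_def)
qed

lemma surplus_le_dual:
  assumes "\<And>u. u \<in> X \<Longrightarrow> 0 \<le> g u" and "\<And>v. v \<in> Y \<Longrightarrow> 0 \<le> h v"
    and "\<And>u v. u \<in> X \<Longrightarrow> v \<in> Y \<Longrightarrow> 3 - graph_dist G u v \<le> g u + h v"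
  shows "short_cycle_surplus G w x y \<le> (\<Sum>u\<in>X. a u * g u) + (\<Sum>v\<in>Y. b v * h v)"
proof -
  define V where "V = (\<Sum>u\<in>X. a u * g u) + (\<Sum>v\<in>Y. b v * h v)"
  have "lly_curvature G w x y \<le> 2 * (a y + b x) - 2 + V"
  proof (rule tendsto_upperbound[OF lly_curvature_tendsto[OF weight edge]])
    have "\<forall>\<^sub>F \<alpha> in at_left 1. \<alpha> \<in> {0 <..< 1 :: real}"
      by (rule eventually_at_left_real) simp
    then show "\<forall>\<^sub>F \<alpha> in at_left 1. alpha_curvature G w \<alpha> x y / (1 - \<alpha>) \<le> 2 * (a y + b x) - 2 + V"
    proof eventually_elim
      case (elim \<alpha>)
      have "1 + (1 - \<alpha>) * (2 - 2 * (a y + b x) - V)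
          \<le> wasserstein1 d (lly_measure G w \<alpha> x) (lly_measure G w \<alpha> y)"
        unfolding V_def by (rule wasserstein_ge_dual) (use elim assms in \<open>auto simp: d_def\<close>)
      then have "alpha_curvature G w \<alpha> x y \<le> (2 * (a y + b x) - 2 + V) * (1 - \<alpha>)"
        by (simp add: alpha_curvature_def d_def algebra_simps)
      then show ?case using elim by (simp add: pos_divide_le_eq)
    qed
  qed simp
  then show ?thesis by (simp add: short_cycle_surplus_def edge_q_eq V_def)
qed

text \<open>
  The surplus lies between all values of the maximisation and all values of the minimisation, and
  duality supplies one value of each kind that agree; so these are the optima.
\<close>
lemma surplus_is_minimum_and_maximum:
  shows "is_minimum
      {(\<Sum>u\<in>X. a u * g u) + (\<Sum>v\<in>Y. b v * h v) | g h :: 'a \<Rightarrow> real.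
         (\<forall>u\<in>X. 0 \<le> g u) \<and> (\<forall>v\<in>Y. 0 \<le> h v) \<and>
         (\<forall>u\<in>X. \<forall>v\<in>Y. 3 - graph_dist G u v \<le> g u + h v)}
      (short_cycle_surplus G w x y)" (is "is_minimum ?D _")
    and "is_maximum
      {(\<Sum>u\<in>X. \<Sum>v\<in>Y. (3 - graph_dist G u v) * \<gamma> u v) | \<gamma> :: 'a \<Rightarrow> 'a \<Rightarrow> real.
         (\<forall>u\<in>X. \<forall>v\<in>Y. 0 \<le> \<gamma> u v) \<and>
         (\<forall>u\<in>X. (\<Sum>v\<in>Y. \<gamma> u v) \<le> a u) \<and>
         (\<forall>v\<in>Y. (\<Sum>u\<in>X. \<gamma> u v) \<le> b v)}
      (short_cycle_surplus G w x y)" (is "is_maximum ?P _")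
proof -
  have "\<exists>\<gamma> g h.
    (\<forall>u\<in>X. \<forall>v\<in>Y. 0 \<le> \<gamma> u v) \<and>
    (\<forall>u\<in>X. (\<Sum>v\<in>Y. \<gamma> u v) \<le> a u) \<and> (\<forall>v\<in>Y. (\<Sum>u\<in>X. \<gamma> u v) \<le> b v) \<and>
    (\<forall>u\<in>X. 0 \<le> g u) \<and> (\<forall>v\<in>Y. 0 \<le> h v) \<and>
    (\<forall>u\<in>X. \<forall>v\<in>Y. 3 - graph_dist G u v \<le> g u + h v) \<and>
    (\<Sum>u\<in>X. a u * g u) + (\<Sum>v\<in>Y. b v * h v) \<le> (\<Sum>u\<in>X. \<Sum>v\<in>Y. (3 - graph_dist G u v) * \<gamma> u v)"
    by (rule partial_transport_duality) (simp_all add: ab_nonneg)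
  then obtain \<gamma> g h where
    \<gamma>: "\<forall>u\<in>X. \<forall>v\<in>Y. 0 \<le> \<gamma> u v"
      "\<forall>u\<in>X. (\<Sum>v\<in>Y. \<gamma> u v) \<le> a u" "\<forall>v\<in>Y. (\<Sum>u\<in>X. \<gamma> u v) \<le> b v"
    and gh: "\<forall>u\<in>X. 0 \<le> g u" "\<forall>v\<in>Y. 0 \<le> h v"
      "\<forall>u\<in>X. \<forall>v\<in>Y. 3 - graph_dist G u v \<le> g u + h v"
    and "(\<Sum>u\<in>X. a u * g u) + (\<Sum>v\<in>Y. b v * h v) \<le> (\<Sum>u\<in>X. \<Sum>v\<in>Y. (3 - graph_dist G u v) * \<gamma> u v)"
    by (elim exE conjE)
  with primal_le_surplus[of \<gamma>] surplus_le_dual[of g h]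
  have eq: "short_cycle_surplus G w x y = (\<Sum>u\<in>X. a u * g u) + (\<Sum>v\<in>Y. b v * h v)"
    "short_cycle_surplus G w x y = (\<Sum>u\<in>X. \<Sum>v\<in>Y. (3 - graph_dist G u v) * \<gamma> u v)"
    by force+
  show "is_minimum ?D (short_cycle_surplus G w x y)"
    unfolding is_minimum_def
  proof (intro conjI CollectI ballI)
    show "\<exists>g h. short_cycle_surplus G w x y = (\<Sum>u\<in>X. a u * g u) + (\<Sum>v\<in>Y. b v * h v) \<and>
         (\<forall>u\<in>X. 0 \<le> g u) \<and> (\<forall>v\<in>Y. 0 \<le> h v) \<and>
         (\<forall>u\<in>X. \<forall>v\<in>Y. 3 - graph_dist G u v \<le> g u + h v)"
      by (rule exI[of _ g], rule exI[of _ h]) (use gh eq(1) in auto)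
  qed (use surplus_le_dual in blast)
  show "is_maximum ?P (short_cycle_surplus G w x y)"
    unfolding is_maximum_def
  proof (intro conjI CollectI ballI)
    show "\<exists>\<gamma>. short_cycle_surplus G w x y = (\<Sum>u\<in>X. \<Sum>v\<in>Y. (3 - graph_dist G u v) * \<gamma> u v) \<and>
         (\<forall>u\<in>X. \<forall>v\<in>Y. 0 \<le> \<gamma> u v) \<and>
         (\<forall>u\<in>X. (\<Sum>v\<in>Y. \<gamma> u v) \<le> a u) \<and>
         (\<forall>v\<in>Y. (\<Sum>u\<in>X. \<gamma> u v) \<le> b v)"
      by (rule exI[of _ \<gamma>]) (use \<gamma> eq(2) in auto)
  qed (use primal_le_surplus in blast)
qed

end

theorem lemma5p2:
  fixes G :: "'a pair_pre_digraph" and w :: "'a set \<Rightarrow> real" and x y :: 'a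
    and X Y :: "'a set" and a b :: "'a \<Rightarrow> real"
  assumes "pair_graph G" and "connected (with_proj G)"
    and "pos_weight G w"
    and "(x, y) \<in> parcs G"
    and "4 \<le> local_girth G x y"
  defines "X \<equiv> nbrs G x - {y}" and "Y \<equiv> nbrs G y - {x}"
    and "a \<equiv> \<lambda>u. w {x, u} / wdeg G w x" and "b \<equiv> \<lambda>v. w {y, v} / wdeg G w y"
  shows "is_minimum
      {(\<Sum>u\<in>X. a u * g u) + (\<Sum>v\<in>Y. b v * h v) | g h :: 'a \<Rightarrow> real.
         (\<forall>u\<in>X. 0 \<le> g u) \<and> (\<forall>v\<in>Y. 0 \<le> h v) \<and>
         (\<forall>u\<in>X. \<forall>v\<in>Y. 3 - graph_dist G u v \<le> g u + h v)}
      (short_cycle_surplus G w x y)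
    \<and> is_maximum
      {(\<Sum>u\<in>X. \<Sum>v\<in>Y. (3 - graph_dist G u v) * \<gamma> u v) | \<gamma> :: 'a \<Rightarrow> 'a \<Rightarrow> real.
         (\<forall>u\<in>X. \<forall>v\<in>Y. 0 \<le> \<gamma> u v) \<and>
         (\<forall>u\<in>X. (\<Sum>v\<in>Y. \<gamma> u v) \<le> a u) \<and>
         (\<forall>v\<in>Y. (\<Sum>u\<in>X. \<gamma> u v) \<le> b v)}
      (short_cycle_surplus G w x y)"
proof -
  interpret pair_graph G by fact
  have "nbrs G x \<inter> nbrs G y = {}"
  proof (rule ccontr)
    assume "nbrs G x \<inter> nbrs G y \<noteq> {}"
    then obtain u where "(x, u) \<in> parcs G" "(y, u) \<in> parcs G" by (auto simp: nbrs_def)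
    then have "local_girth G x y \<le> 3" using local_girth_triangle assms(4) by blast
    with assms(5) have "(4 :: enat) \<le> 3" by (rule order_trans)
    then show False by simp
  qed
  then interpret E: triangle_free_edge G w x y
    by unfold_locales (use assms in auto)
  show ?thesis
    unfolding X_def Y_def a_def b_def
    using E.surplus_is_minimum_and_maximum unfolding E.X_def E.Y_def E.a_def E.b_def by simp
qed

end
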